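(* Let $\mathcal C(N)$ denote the collection of all graphs on $N\ge 1$ vertices that are disjoint unions of cliques. Then for any $0<p<1/2$, $$\inf_{\widehat{\mathsf{cc}}}\ \sup_{G\in\mathcal C(N)}\mathbb E_G|\widehat{\mathsf{cc}}-\mathsf{cc}(G)|^2\le N^2\,(N/4)^{-\frac{p}{2-3p}}.$$
   Context: Graphs are finite, simple and undirected; $\mathsf{cc}(G)$ is the number of connected components of $G$. Bernoulli sampling model: given a (deterministic, unknown) graph $G=(V,E)$, each vertex is included in a random set $S\subset V$ independently with probability $p$, and one observes the induced subgraph $\widetilde G=G[S]$ (up to isomorphism). An estimator $\widehat{\mathsf{cc}}$ is any real-valued function of $\widetilde G$ (it may depend on the known parameters $N,p$); $\mathbb E_G$ is the expectation when the parent graph is $G$. *)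

theory Defs
  imports
    "HOL-Probability.Probability"
    "Graph_Theory.Graph_Theory"
begin

text \<open>
  Finite simple undirected graphs are values \<open>G :: nat pair_pre_digraph\<close> with \<open>pair_graph G\<close>:
  a finite vertex set together with an irreflexive symmetric relation.  Vertices are taken
  from \<open>nat\<close>, which contains a copy of every finite graph; the null graph is allowed (it
  occurs as an induced subgraph on the empty sample).
\<close>

text \<open>
  In a symmetric digraph the strongly connected components are the connected components of
  the undirected graph.
\<close>

definition cc :: "nat pair_pre_digraph \<Rightarrow> nat" where
  "cc G = card (pre_digraph.sccs (with_proj G))"

definition disjoint_union_of_cliques :: "nat pair_pre_digraph \<Rightarrow> bool" where
  "disjoint_union_of_cliques G \<longleftrightarrow>
     (\<exists>P. partition_on (pverts G) P \<and>
          parcs G = (\<Union>B\<in>P. {(u, v). u \<in> B \<and> v \<in> B \<and> u \<noteq> v}))"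

definition clique_graphs :: "nat \<Rightarrow> nat pair_pre_digraph set" where
  "clique_graphs N =
     {G. pair_graph G \<and> card (pverts G) = N \<and> disjoint_union_of_cliques G}"

definition bernoulli_subset :: "real \<Rightarrow> 'a set \<Rightarrow> 'a set pmf" where
  "bernoulli_subset p V =
     map_pmf (\<lambda>f. {v \<in> V. f v}) (Pi_pmf V False (\<lambda>_. bernoulli_pmf p))"

definition sampled_graph ::
    "real \<Rightarrow> nat pair_pre_digraph \<Rightarrow> (nat, nat \<times> nat) pre_digraph pmf" where
  "sampled_graph p G = map_pmf (\<lambda>S. with_proj G \<restriction> S) (bernoulli_subset p (pverts G))"

text \<open>
  Observing the sampled graph up to isomorphism means that an estimator is an
  isomorphism-invariant function.  Its dependence on the known \<open>N\<close> and \<open>p\<close> is implicit: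
  the minimax infimum over estimators is taken for fixed \<open>N\<close> and \<open>p\<close>.
\<close>

definition estimators :: "((nat, nat \<times> nat) pre_digraph \<Rightarrow> real) set" where
  "estimators = {h. \<forall>H H'. graph H \<longrightarrow> graph H' \<longrightarrow> digraph_iso H H' \<longrightarrow> h H = h H'}"

definition risk ::
    "real \<Rightarrow> ((nat, nat \<times> nat) pre_digraph \<Rightarrow> real) \<Rightarrow> nat pair_pre_digraph \<Rightarrow> ennreal" where
  "risk p h G = (\<integral>\<^sup>+ H. ennreal (\<bar>h H - real (cc G)\<bar>\<^sup>2) \<partial>measure_pmf (sampled_graph p G))"

end

theory Submission
  imports Defs "HOL-Real_Asymp.Real_Asymp"
begin

text \<open>
  Put \<open>q = 1 - p\<close>.  A clique on \<open>k \<ge> 1\<close> vertices is sampled down to a clique on \<open>X\<close> vertices with \<open>X\<close>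
  binomial, and \<open>1 - (-q/p)\<^sup>X\<close> is an unbiased estimate of \<open>1\<close>, but of exponentially large variance.  It
  is smoothed to \<open>g(X) = 1 - (-q/p)\<^sup>X P(L \<ge> X)\<close> with \<open>L\<close> Poisson of mean \<open>l\<close>.  Summation by parts shows
  that the bias of \<open>g(X)\<close> is \<open>-q\<^sup>k e\<^bsup>-l\<^esup> L\<^bsub>k-1\<^esub>(l)\<close> with the Laguerre polynomial \<open>L\<^bsub>k-1\<^esub>\<close>, whose absolute value
  is at most \<open>e\<^bsup>l/2\<^esup>\<close>; and \<open>\<bar>g\<bar> \<le> E (q/p)\<^sup>L + 1 \<le> 2 e\<^bsup>l(q/p-1)\<^esup>\<close>, while \<open>g(0) = 0\<close>, so that the variance of
  \<open>g(X)\<close> is at most \<open>(1 - q\<^sup>k) 4 e\<^bsup>2l(q/p-1)\<^esup>\<close>.  Choosing \<open>l = p/(2-3p) ln (N/4)\<close> makes the last factor equal to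
  \<open>N e\<^bsup>-l\<^esup>\<close>; by Cauchy-Schwarz the squared bias of the whole estimator is at most \<open>N e\<^bsup>-l\<^esup>\<close> times the sum
  of the \<open>q\<^sup>k\<close> over all cliques, and the weights \<open>q\<^sup>k\<close> and \<open>1 - q\<^sup>k\<close> add up to \<open>1\<close>.  For \<open>N \<le> 4\<close> the estimator
  \<open>0\<close> suffices.
\<close>

text \<open>Pascal's rule in summed form. For a sign-alternating \<open>f\<close> the right side is
  a sum of differences, which is how summation by parts of Poisson tails is carried out.\<close>

lemma sum_binomial_Suc:
  fixes f :: "nat \<Rightarrow> 'a::comm_semiring_1"
  shows "(\<Sum>k\<le>Suc n. of_nat (Suc n choose k) * f k) = (\<Sum>k\<le>n. of_nat (n choose k) * (f k + f (Suc k)))"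
proof -
  have "(\<Sum>k\<le>Suc n. of_nat (Suc n choose k) * f k)
      = f 0 + (\<Sum>k\<le>n. of_nat (n choose Suc k) * f (Suc k)) + (\<Sum>k\<le>n. of_nat (n choose k) * f (Suc k))"
    by (simp only: sum.atMost_Suc_shift binomial_Suc_Suc of_nat_add distrib_right sum.distrib) 
       (simp add: ac_simps)
  also have "f 0 + (\<Sum>k\<le>n. of_nat (n choose Suc k) * f (Suc k)) = (\<Sum>k\<le>Suc n. of_nat (n choose k) * f k)"
    by (simp only: sum.atMost_Suc_shift) simp
  also have "\<dots> = (\<Sum>k\<le>n. of_nat (n choose k) * f k)"
    by (simp add: binomial_eq_0)
  finally show ?thesis
    by (simp only: distrib_left sum.distrib)
qed

section \<open>Poisson-Charlier and Laguerre polynomials\<close>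

text \<open>The value \<open>x - 1\<close>, truncated at \<open>x = 0\<close>, then only occurs with coefficient \<open>0\<close>.\<close>

primrec charlier :: "real \<Rightarrow> nat \<Rightarrow> nat \<Rightarrow> real" where
  "charlier a 0 x = 1"
| "charlier a (Suc n) x = charlier a n x - real x / a * charlier a n (x - 1)"

text \<open>The defining recursion raises the degree; a forward difference in \<open>x\<close>
  lowers it. The induction subtracts the recursion at \<open>x\<close> from the one at
  \<open>Suc x\<close>.\<close>

lemma charlier_Suc_Suc:
  "charlier a (Suc n) (Suc x) = charlier a (Suc n) x - real (Suc n) / a * charlier a n x"
proof (induction n arbitrary: x)
  case 0
  then show ?case by (simp add: add_divide_distrib)
next
  case (Suc n)
  define y where "y = x - 1"
  have 1: "charlier a (Suc n) (Suc x) = charlier a (Suc n) x - real (Suc n) / a * charlier a n x"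
    by (rule Suc)
  \<comment> \<open>The factor \<open>real x\<close> covers \<open>x = 0\<close>, where
    \<open>y\<close> is \<open>0\<close> and not a predecessor.\<close>
  have 2: "real x * (charlier a (Suc n) x - charlier a (Suc n) y) = - (real (Suc n) / a) * (real x * charlier a n y)"
  proof (cases x)
    case (Suc z)
    then show ?thesis
      using Suc.IH[of z] by (simp add: y_def del: charlier.simps of_nat_Suc)
  qed simp
  have 3: "charlier a (Suc n) x = charlier a n x - real x * charlier a n y / a"
    by (simp add: y_def)
  have "charlier a (Suc (Suc n)) (Suc x) - charlier a (Suc (Suc n)) x
      = (charlier a (Suc n) (Suc x) - charlier a (Suc n) x) - charlier a (Suc n) x / a
        - (real x * (charlier a (Suc n) x - charlier a (Suc n) y)) / a"
    unfolding charlier.simps(2)[of a "Suc n"] y_def diff_Suc_1 of_nat_Suc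
    by (simp del: charlier.simps add: algebra_simps divide_inverse)
  also have "\<dots> = - (real (Suc n) / a) * (charlier a n x - real x * charlier a n y / a) - charlier a (Suc n) x / a"
    unfolding 1 2 by (simp del: charlier.simps of_nat_Suc add: algebra_simps)
  also have "\<dots> = - (real (Suc (Suc n)) / a) * charlier a (Suc n) x"
    unfolding 3[symmetric] by (simp del: charlier.simps add: algebra_simps add_divide_distrib)
  finally show ?case by (simp del: charlier.simps)
qed

text \<open>\<open>fact k * (x choose k)\<close> is a falling factorial, and \<open>x\<close> times
  that of \<open>x - 1\<close> is the next one; Pascal's rule then matches the recursion.\<close>

lemma charlier_eq_sum:
  "charlier a n x = (\<Sum>k\<le>n. real (n choose k) * (fact k * real (x choose k) * (- 1 / a) ^ k))"
proof (induction n arbitrary: x)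
  case 0
  then show ?case by simp
next
  case (Suc n)
  have *: "real x * (fact k * real ((x - 1) choose k)) = fact (Suc k) * real (x choose Suc k)" for k
  proof (cases x)
    case (Suc y)
    have "real (Suc k) * real (Suc y choose Suc k) = real (Suc y) * real (y choose k)"
      by (metis Suc_times_binomial of_nat_mult)
    then have "real x * (fact k * real ((x - 1) choose k)) = fact k * (real (Suc k) * real (Suc y choose Suc k))"
      using Suc by simp
    then show ?thesis using Suc by (simp del: binomial_Suc_Suc of_nat_Suc)
  qed simp
  have **: "real x / a * (real (n choose k) * (fact k * real ((x - 1) choose k) * (- 1 / a) ^ k))
      = - (real (n choose k) * (fact (Suc k) * real (x choose Suc k) * (- 1 / a) ^ Suc k))" for k
    unfolding *[symmetric] by (simp add: divide_inverse mult_ac)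
  show ?case
    unfolding charlier.simps Suc sum_binomial_Suc sum_distrib_left **
    by (simp only: sum_negf sum.distrib distrib_left diff_minus_eq_add)
qed

text \<open>A crude bound, polynomial in \<open>x\<close>, that serves convergence against the
  Poisson weight.\<close>

lemma abs_charlier_le:
  assumes "a > 0"
  shows "\<bar>charlier a n x\<bar> \<le> (1 + 1 / a) ^ n * (real x + 1) ^ n"
proof (induction n arbitrary: x)
  case 0
  then show ?case by simp
next
  case (Suc n)
  let ?K = "(1 + 1 / a) ^ n * (real x + 1) ^ n"
  have "\<bar>charlier a n (x - 1)\<bar> \<le> (1 + 1 / a) ^ n * (real (x - 1) + 1) ^ n"
    by (rule Suc)
  also have "\<dots> \<le> ?K"
    using assms by (intro mult_left_mono power_mono) auto
  finally have 1: "real x / a * \<bar>charlier a n (x - 1)\<bar> \<le> real x / a * ?K"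
    using assms by (intro mult_left_mono) auto
  have "\<bar>charlier a (Suc n) x\<bar> \<le> \<bar>charlier a n x\<bar> + real x / a * \<bar>charlier a n (x - 1)\<bar>"
    using assms by (simp add: abs_mult order.trans[OF abs_triangle_ineq4])
  also have "\<dots> \<le> ?K + real x / a * ?K"
    using 1 Suc[of x] by simp
  also have "\<dots> = (1 + real x / a) * ?K"
    by (simp add: algebra_simps)
  also have "\<dots> \<le> ((1 + 1 / a) * (real x + 1)) * ?K"
    using assms by (intro mult_right_mono) (auto simp: field_simps)
  finally show ?case by (simp add: mult_ac)
qed

text \<open>Polynomial growth stays below \<open>2 ^ x\<close>, so the exponential series at
  \<open>2 * a\<close> dominates.\<close>

lemma summable_charlier_product:
  assumes "a > 0"
  shows "summable (\<lambda>x. a ^ x / fact x * (charlier a m x * charlier a n x))"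
proof (rule summable_comparison_test_bigo)
  have "summable (\<lambda>x. (2 * a) ^ x / fact x)"
    using summable_exp[of "2 * a"] by (simp add: field_simps)
  then show "summable (\<lambda>x. norm ((2 * a) ^ x / fact x))"
    using assms by simp
  have "(\<lambda>x. charlier a m x * charlier a n x) \<in> O(\<lambda>x. (real x + 1) ^ (m + n))"
  proof (rule bigoI, rule always_eventually, rule allI)
    fix x
    show "norm (charlier a m x * charlier a n x) \<le> (1 + 1 / a) ^ (m + n) * norm ((real x + 1) ^ (m + n))"
      using mult_mono[OF abs_charlier_le[OF assms, of m x] abs_charlier_le[OF assms, of n x]] assms
      by (simp add: abs_mult power_add mult_ac)
  qed
  also have "(\<lambda>x. (real x + 1) ^ (m + n)) \<in> O(\<lambda>x. 2 ^ x)"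
    by real_asymp
  finally have "(\<lambda>x. a ^ x / fact x * (charlier a m x * charlier a n x)) \<in> O(\<lambda>x. a ^ x / fact x * 2 ^ x)"
    by (intro landau_o.big.mult) auto
  then show "(\<lambda>x. a ^ x / fact x * (charlier a m x * charlier a n x)) \<in> O(\<lambda>x. (2 * a) ^ x / fact x)"
    by (simp add: power_mult_distrib mult_ac)
qed

text \<open>
  The induction step is a summation by parts: shifting \<open>x\<close> in the Poisson weight turns one factor
  into its forward difference, which lowers the degree.
\<close>

lemma charlier_norm_sums:
  assumes "a > 0"
  shows "(\<lambda>x. a ^ x / fact x * (charlier a n x)\<^sup>2) sums (exp a * fact n / a ^ n)"
proof (induction n)
  case 0
  show ?case using exp_converges[of a] by (simp add: field_simps)
next
  case (Suc n)
  define w where "w x = a ^ x / fact x" for x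
  have w: "w (Suc x) * (real (Suc x) / a) = w x" for x
    using assms by (simp add: w_def field_simps del: of_nat_Suc)
  \<comment> \<open>The unspecified value \<open>s\<close> cancels in the final subtraction.\<close>
  obtain s where s: "(\<lambda>x. w x * (charlier a n x * charlier a (Suc n) x)) sums s"
    using summable_charlier_product[OF assms] unfolding w_def by blast
  have eq: "w (Suc x) * (real (Suc x) / a * charlier a n x * charlier a (Suc n) (Suc x))
      = w x * (charlier a n x * charlier a (Suc n) x) - real (Suc n) / a * (w x * (charlier a n x)\<^sup>2)" for x
  proof -
    have "w (Suc x) * (real (Suc x) / a * charlier a n x * charlier a (Suc n) (Suc x))
        = (w (Suc x) * (real (Suc x) / a)) * (charlier a n x * charlier a (Suc n) (Suc x))"
      by (simp only: mult_ac)
    then show ?thesis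
      unfolding w charlier_Suc_Suc
      by (simp del: charlier.simps of_nat_Suc add: power2_eq_square algebra_simps)
  qed
  have "(\<lambda>x. w (Suc x) * (real (Suc x) / a * charlier a n x * charlier a (Suc n) (Suc x)))
      sums (s - real (Suc n) / a * (exp a * fact n / a ^ n))"
    unfolding eq by (intro sums_diff sums_mult s Suc[folded w_def])
  \<comment> \<open>The term at \<open>x = 0\<close> vanishes through the factor
    \<open>real x\<close>, so undoing the shift leaves the sum unchanged.\<close>
  then have "(\<lambda>x. w x * (real x / a * charlier a n (x - 1) * charlier a (Suc n) x))
      sums (s - real (Suc n) / a * (exp a * fact n / a ^ n))"
    by (subst (asm) sums_Suc_iff[where f = "\<lambda>x. w x * (real x / a * charlier a n (x - 1) * charlier a (Suc n) x)", simplified diff_Suc_1])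
       (simp del: charlier.simps)
  from sums_diff[OF s this]
  have "(\<lambda>x. w x * (charlier a (Suc n) x)\<^sup>2) sums (real (Suc n) / a * (exp a * fact n / a ^ n))"
    by (simp add: power2_eq_square algebra_simps)
  then show ?case
    by (simp add: w_def mult_ac)
qed

section \<open>Laguerre polynomials as diagonal values of Charlier polynomials\<close>

definition laguerre :: "nat \<Rightarrow> real \<Rightarrow> real" where
  "laguerre n a = (\<Sum>k\<le>n. real (n choose k) * (- a) ^ k / fact k)"

text \<open>Reversing the explicit sum at \<open>x = n\<close> turns its coefficients into
  \<open>fact n / fact k\<close>.\<close>

lemma charlier_diagonal:
  assumes "a \<noteq> 0"
  shows "charlier a n n = fact n / (- a) ^ n * laguerre n a"
proof -
  have "charlier a n n = (\<Sum>k\<le>n. real (n choose (n - k)) * (fact (n - k) * real (n choose (n - k)) * (- 1 / a) ^ (n - k)))"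
    unfolding charlier_eq_sum by (rule sum.reindex_bij_witness[where i = "\<lambda>k. n - k" and j = "\<lambda>k. n - k"]) auto
  also have "\<dots> = (\<Sum>k\<le>n. fact n / (- a) ^ n * (real (n choose k) * (- a) ^ k / fact k))"
  proof (rule sum.cong)
    fix k assume "k \<in> {..n}"
    then have k: "k \<le> n" by simp
    have "fact k * fact (n - k) * real (n choose k) = fact n"
      using binomial_fact_lemma[OF k] by (metis of_nat_fact of_nat_mult)
    then have "fact (n - k) * real (n choose k) = fact n / fact k"
      by (simp add: field_simps)
    moreover have "(- 1 / a) ^ (n - k) = (- a) ^ k / (- a) ^ n"
    proof -
      have "(- 1 / a) ^ (n - k) = 1 / (- a) ^ (n - k)"
        by (metis minus_divide_left minus_divide_right power_one_over)
      also have "\<dots> = (- a) ^ k / (- a) ^ n"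
        using assms k by (simp add: power_diff)
      finally show ?thesis .
    qed
    ultimately show "real (n choose (n - k)) * (fact (n - k) * real (n choose (n - k)) * (- 1 / a) ^ (n - k))
       = fact n / (- a) ^ n * (real (n choose k) * (- a) ^ k / fact k)"
      using k by (simp add: binomial_symmetric[symmetric] mult_ac)
  qed simp
  finally show ?thesis
    by (simp add: laguerre_def sum_distrib_left)
qed

text \<open>Up to scaling, the left-hand side is the single term \<open>x = n\<close> of the series for the norm of the
  \<open>n\<close>-th Charlier polynomial.\<close>

lemma laguerre_square_le:
  assumes "a > 0"
  shows "(laguerre n a)\<^sup>2 \<le> exp a"
proof -
  have "a ^ n / fact n * (charlier a n n)\<^sup>2 \<le> (\<Sum>x. a ^ x / fact x * (charlier a n x)\<^sup>2)"
    using sum_le_suminf[OF sums_summable[OF charlier_norm_sums[OF assms, of n]], of "{n}"] assms by simp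
  also have "\<dots> = exp a * fact n / a ^ n"
    using charlier_norm_sums[OF assms] by (simp add: sums_iff)
  also have "a ^ n / fact n * (charlier a n n)\<^sup>2 = fact n / a ^ n * (laguerre n a)\<^sup>2"
  proof -
    have "((- a) ^ n)\<^sup>2 = (a ^ n)\<^sup>2" by (metis power2_minus power_even_eq power_mult mult.commute)
    then show ?thesis
      using assms by (simp add: charlier_diagonal power_mult_distrib power_divide power2_eq_square)
  qed
  finally show ?thesis
    using assms by (simp add: field_simps)
qed

section \<open>Poisson-smoothed weights of cliques\<close>

text \<open>The probability that a Poisson variable of mean \<open>l\<close> is at least \<open>m\<close>.\<close>

definition poisson_tail :: "real \<Rightarrow> nat \<Rightarrow> real" where
  "poisson_tail l m = 1 - exp (- l) * (\<Sum>i<m. l ^ i / fact i)"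

text \<open>A Markov-type bound: \<open>r ^ m\<close> is at most \<open>r ^ i\<close> on the tail
  \<open>i \<ge> m\<close>, so the product is at most the mean of \<open>r ^ L\<close> for a Poisson
  variable \<open>L\<close> of mean \<open>l\<close>.\<close>

lemma poisson_tail_nonneg_le:
  assumes "0 \<le> l" "1 \<le> r"
  shows "0 \<le> poisson_tail l m" and "r ^ m * poisson_tail l m \<le> exp (l * (r - 1))"
proof -
  have e: "(\<lambda>i. y ^ i / fact i) sums exp y" for y :: real
    using exp_converges[of y] by (simp add: field_simps)
  have sm: "summable (\<lambda>i. y ^ (i + m) / fact (i + m))" for y :: real
    using e[of y] by (subst summable_iff_shift[where f = "\<lambda>i. y ^ i / fact i"]) (auto simp: sums_iff)
  have split: "exp y = (\<Sum>i. y ^ (i + m) / fact (i + m)) + (\<Sum>i<m. y ^ i / fact i)" for y :: real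
    using suminf_split_initial_segment[OF sums_summable[OF e[of y]], of m] sums_unique[OF e[of y]] by simp
  have tail: "poisson_tail l m = exp (- l) * (\<Sum>i. l ^ (i + m) / fact (i + m))"
    using split[of l] by (simp add: poisson_tail_def algebra_simps exp_minus_inverse flip: exp_add)
       (metis add.right_inverse distrib_left exp_add exp_zero add.commute)
  show "0 \<le> poisson_tail l m"
    unfolding tail using assms by (intro mult_nonneg_nonneg suminf_nonneg sm) auto
  have "r ^ m * (\<Sum>i. l ^ (i + m) / fact (i + m)) = (\<Sum>i. r ^ m * (l ^ (i + m) / fact (i + m)))"
    by (rule suminf_mult[OF sm, symmetric])
  also have "\<dots> \<le> (\<Sum>i. (l * r) ^ (i + m) / fact (i + m))"
  proof (rule suminf_le[OF _ summable_mult[OF sm] sm])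
    fix i
    have "r ^ m * l ^ (i + m) \<le> r ^ (i + m) * l ^ (i + m)"
      using assms by (intro mult_right_mono power_increasing) auto
    then show "r ^ m * (l ^ (i + m) / fact (i + m)) \<le> (l * r) ^ (i + m) / fact (i + m)"
      by (simp add: power_mult_distrib divide_right_mono mult.commute)
  qed
  also have "\<dots> \<le> exp (l * r)"
    unfolding split[of "l * r"] using assms by (simp add: sum_nonneg)
  finally have "exp (- l) * (r ^ m * (\<Sum>i. l ^ (i + m) / fact (i + m))) \<le> exp (- l) * exp (l * r)"
    by simp
  then show "r ^ m * poisson_tail l m \<le> exp (l * (r - 1))"
    unfolding tail by (simp add: algebra_simps flip: exp_add)
qed

lemma poisson_tail_diff: "poisson_tail l m - poisson_tail l (Suc m) = exp (- l) * (l ^ m / fact m)"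
  by (simp add: poisson_tail_def algebra_simps)

definition clique_weight :: "real \<Rightarrow> real \<Rightarrow> nat \<Rightarrow> real" where
  "clique_weight r l m = 1 - (- r) ^ m * poisson_tail l m"

lemma clique_weight_0 [simp]: "clique_weight r l 0 = 0"
  by (simp add: clique_weight_def poisson_tail_def)

lemma clique_weight_square_le:
  assumes "0 \<le> l" "1 \<le> r"
  shows "(clique_weight r l m)\<^sup>2 \<le> 4 * exp (2 * l * (r - 1))"
proof -
  have "\<bar>clique_weight r l m\<bar> \<le> 1 + r ^ m * poisson_tail l m"
    unfolding clique_weight_def using assms poisson_tail_nonneg_le(1)[OF assms]
    by (intro order.trans[OF abs_triangle_ineq4]) (simp add: abs_mult power_abs)
  also have "\<dots> \<le> 1 + exp (l * (r - 1))"
    using poisson_tail_nonneg_le(2)[OF assms] by simp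
  also have "\<dots> \<le> 2 * exp (l * (r - 1))"
    using assms by simp
  finally have "\<bar>clique_weight r l m\<bar>\<^sup>2 \<le> (2 * exp (l * (r - 1)))\<^sup>2"
    by (intro power_mono) auto
  then show ?thesis
    by (simp add: power_mult_distrib mult.assoc flip: exp_double)
qed

text \<open>The powers of \<open>p\<close> cancel against those in \<open>(- r) ^ i\<close> for
  \<open>r = (1 - p) / p\<close>, and the powers of \<open>1 - p\<close> merge into a common factor.
  An alternating binomial sum of tails remains.\<close>

lemma expectation_clique_weight:
  assumes p: "0 < p" "p < 1"
  shows "measure_pmf.expectation (binomial_pmf (Suc k) p) (clique_weight ((1 - p) / p) l)
    = 1 - (1 - p) ^ Suc k * (exp (- l) * laguerre k l)"
proof -
  have "measure_pmf.expectation (binomial_pmf (Suc k) p) (clique_weight ((1 - p) / p) l)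
    = (\<Sum>i\<le>Suc k. real (Suc k choose i) * p ^ i * (1 - p) ^ (Suc k - i)
        - (1 - p) ^ Suc k * (real (Suc k choose i) * ((- 1) ^ i * poisson_tail l i)))"
  proof (subst expectation_binomial_pmf')
    show "p \<in> {0..1}" using p by simp
    show "(\<Sum>i\<le>Suc k. (real (Suc k choose i) * p ^ i * (1 - p) ^ (Suc k - i)) *\<^sub>R clique_weight ((1 - p) / p) l i)
      = (\<Sum>i\<le>Suc k. real (Suc k choose i) * p ^ i * (1 - p) ^ (Suc k - i)
        - (1 - p) ^ Suc k * (real (Suc k choose i) * ((- 1) ^ i * poisson_tail l i)))"
    proof (rule sum.cong)
      fix i assume "i \<in> {..Suc k}"
      then have pow: "(1 - p) ^ Suc k = (1 - p) ^ (Suc k - i) * (1 - p) ^ i"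
        by (subst power_add[symmetric]) simp
      have "p ^ i * (- ((1 - p) / p)) ^ i = (- 1) ^ i * (1 - p) ^ i"
        using p by (simp flip: power_mult_distrib)
      moreover have "(real (Suc k choose i) * p ^ i * (1 - p) ^ (Suc k - i)) *\<^sub>R clique_weight ((1 - p) / p) l i
        = real (Suc k choose i) * p ^ i * (1 - p) ^ (Suc k - i)
        - (real (Suc k choose i) * (1 - p) ^ (Suc k - i) * poisson_tail l i) * (p ^ i * (- ((1 - p) / p)) ^ i)"
        by (simp only: clique_weight_def real_scaleR_def right_diff_distrib mult_1_right mult_ac)
      ultimately show "(real (Suc k choose i) * p ^ i * (1 - p) ^ (Suc k - i)) *\<^sub>R clique_weight ((1 - p) / p) l i
        = real (Suc k choose i) * p ^ i * (1 - p) ^ (Suc k - i)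
        - (1 - p) ^ Suc k * (real (Suc k choose i) * ((- 1) ^ i * poisson_tail l i))"
        unfolding pow by (simp only: mult_ac)
    qed simp
  qed
  also have "\<dots> = (p + (1 - p)) ^ Suc k
      - (1 - p) ^ Suc k * (\<Sum>i\<le>Suc k. real (Suc k choose i) * ((- 1) ^ i * poisson_tail l i))"
    unfolding sum_subtractf sum_distrib_left binomial_ring ..
  \<comment> \<open>Pascal's rule with alternating signs produces differences of consecutive tails,
    that is, Poisson point probabilities.\<close>
  also have "(\<Sum>i\<le>Suc k. real (Suc k choose i) * ((- 1) ^ i * poisson_tail l i))
      = (\<Sum>i\<le>k. real (k choose i) * ((- 1) ^ i * (poisson_tail l i - poisson_tail l (Suc i))))"
    unfolding sum_binomial_Suc by (simp add: algebra_simps)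
  also have "\<dots> = exp (- l) * laguerre k l"
    unfolding poisson_tail_diff laguerre_def sum_distrib_left
    by (rule sum.cong) (simp_all add: power_minus[of l])
  finally show ?thesis by simp
qed

text \<open>The weight vanishes at \<open>0\<close>, an outcome of probability
  \<open>(1 - p) ^ k\<close>; elsewhere the uniform bound applies.\<close>

lemma expectation_clique_weight_square_le:
  assumes p: "0 < p" "p \<le> 1 / 2" and l: "0 \<le> l"
  shows "measure_pmf.expectation (binomial_pmf k p) (\<lambda>i. (clique_weight ((1 - p) / p) l i)\<^sup>2)
    \<le> (1 - (1 - p) ^ k) * (4 * exp (2 * l * ((1 - p) / p - 1)))"
proof -
  let ?M = "4 * exp (2 * l * ((1 - p) / p - 1))"
  have p': "p \<in> {0..1}" and r: "1 \<le> (1 - p) / p" using p by auto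
  have "measure_pmf.expectation (binomial_pmf k p) (\<lambda>i. (clique_weight ((1 - p) / p) l i)\<^sup>2)
      \<le> measure_pmf.expectation (binomial_pmf k p) (\<lambda>i. ?M - ?M * indicator {0} i)"
    using clique_weight_square_le[OF l r] p'
    by (intro integral_mono integrable_binomial_pmf) (auto simp: indicator_def)
  also have "\<dots> = ?M - ?M * pmf (binomial_pmf k p) 0"
    using p' by (subst Bochner_Integration.integral_diff) (auto simp: pmf.rep_eq)
  finally show ?thesis
    using p' by (simp add: algebra_simps)
qed

section \<open>Bernoulli samples of a partitioned set\<close>

lemma expectation_pair_pmf_finite:
  fixes h :: "'a \<times> 'b \<Rightarrow> real"
  assumes "finite (set_pmf P)" "finite (set_pmf Q)"
  shows "measure_pmf.expectation (pair_pmf P Q) h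
    = measure_pmf.expectation P (\<lambda>x. measure_pmf.expectation Q (\<lambda>y. h (x, y)))"
proof -
  have "pair_pmf P Q = P \<bind> (\<lambda>x. map_pmf (Pair x) Q)"
    by (simp add: pair_pmf_def map_pmf_def)
  then have "measure_pmf.expectation (pair_pmf P Q) h
      = (\<Sum>x\<in>set_pmf P. pmf P x *\<^sub>R measure_pmf.expectation (map_pmf (Pair x) Q) h)"
    using assms by (simp add: pmf_expectation_bind[where A = "set_pmf P"])
  also have "\<dots> = measure_pmf.expectation P (\<lambda>x. measure_pmf.expectation Q (\<lambda>y. h (x, y)))"
    using assms by (subst integral_measure_pmf[of "set_pmf P"]) simp_all
  finally show ?thesis .
qed

lemma expectation_pair_pmf_add_square:
  fixes f :: "'a \<Rightarrow> real" and g :: "'b \<Rightarrow> real"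
  assumes fin: "finite (set_pmf P)" "finite (set_pmf Q)"
  shows "measure_pmf.expectation (pair_pmf P Q) (\<lambda>(x, y). (f x + g y)\<^sup>2)
    = measure_pmf.expectation P (\<lambda>x. (f x)\<^sup>2)
      + 2 * measure_pmf.expectation P f * measure_pmf.expectation Q g
      + measure_pmf.expectation Q (\<lambda>y. (g y)\<^sup>2)"
proof -
  have P [simp]: "integrable P h" and Q [simp]: "integrable Q k" for h :: "'a \<Rightarrow> real" and k :: "'b \<Rightarrow> real"
    using fin by (auto intro: integrable_measure_pmf_finite)
  show ?thesis
    by (simp add: expectation_pair_pmf_finite[OF fin] power2_sum)
qed

lemma set_pmf_bernoulli_subset:
  "set_pmf (bernoulli_subset p A) \<subseteq> Pow A"
  by (auto simp: bernoulli_subset_def)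

lemma finite_set_pmf_bernoulli_subset [simp]:
  "finite A \<Longrightarrow> finite (set_pmf (bernoulli_subset p A))"
  using set_pmf_bernoulli_subset[of p A] by (meson finite_Pow_iff finite_subset)

lemma map_pmf_card_bernoulli_subset:
  assumes "finite A" "p \<in> {0..1}"
  shows "map_pmf card (bernoulli_subset p A) = binomial_pmf (card A) p"
  using binomial_pmf_altdef'[OF assms(1) refl assms(2), where dflt = False]
  by (simp add: bernoulli_subset_def map_pmf_comp)

text \<open>Independent coin flips on disjoint sets give independent samples.\<close>

lemma bernoulli_subset_Un:
  assumes "finite A" "finite B" "A \<inter> B = {}"
  shows "bernoulli_subset p (A \<union> B)
    = map_pmf (\<lambda>(S, T). S \<union> T) (pair_pmf (bernoulli_subset p A) (bernoulli_subset p B))"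
  unfolding bernoulli_subset_def Pi_pmf_union[OF assms] map_pair[symmetric] map_pmf_comp
  using assms(3) by (intro map_pmf_cong refl) auto

text \<open>Samples of disjoint blocks are independent, so means and variances add. A single
  induction proves both, since they share the splitting into one block and the rest.\<close>

lemma bernoulli_subset_block_sum:
  fixes F :: "'a set \<Rightarrow> real"
  assumes "finite P" "disjoint P" "\<And>B. B \<in> P \<Longrightarrow> finite B"
  shows "measure_pmf.expectation (bernoulli_subset p (\<Union>P)) (\<lambda>S. \<Sum>B\<in>P. F (S \<inter> B))
      = (\<Sum>B\<in>P. measure_pmf.expectation (bernoulli_subset p B) F)" (is ?mean)
    and "measure_pmf.variance (bernoulli_subset p (\<Union>P)) (\<lambda>S. \<Sum>B\<in>P. F (S \<inter> B))
      = (\<Sum>B\<in>P. measure_pmf.variance (bernoulli_subset p B) F)" (is ?variance)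
proof -
  let ?E = "\<lambda>A. measure_pmf.expectation (bernoulli_subset p A)"
  have variance_eq: "measure_pmf.variance (bernoulli_subset p A) f = ?E A (\<lambda>S. (f S)\<^sup>2) - (?E A f)\<^sup>2"
    if "finite A" for f :: "'a set \<Rightarrow> real" and A
    by (rule measure_pmf.variance_eq) (use that in \<open>auto intro: integrable_measure_pmf_finite\<close>)
  have "?mean \<and> ?variance"
    using assms
  proof (induction P rule: finite_induct)
    case empty
    then show ?case by simp
  next
    case (insert B P)
    define X where "X T = (\<Sum>C\<in>P. F (T \<inter> C))" for T
    have dj: "disjoint P" "B \<inter> \<Union>P = {}"
      using insert.prems(1) insert.hyps(2) by (simp_all add: pairwise_insert) (auto simp: disjnt_def)
    have fin: "finite B" "finite (\<Union>P)"
      using insert.prems(2) insert.hyps(1) by auto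
    \<comment> \<open>A general \<open>g\<close> serves the mean (identity) and the second moment
      (square) alike.\<close>
    have split: "?E (\<Union>(insert B P)) (\<lambda>S. g (\<Sum>C\<in>insert B P. F (S \<inter> C)))
       = measure_pmf.expectation (pair_pmf (bernoulli_subset p B) (bernoulli_subset p (\<Union>P)))
           (\<lambda>(S, T). g (F S + X T))" for g :: "real \<Rightarrow> real"
    proof -
      have "(\<Sum>C\<in>insert B P. F ((S \<union> T) \<inter> C)) = F S + X T" if "S \<subseteq> B" "T \<subseteq> \<Union>P" for S T
      proof -
        have "(S \<union> T) \<inter> B = S" "\<And>C. C \<in> P \<Longrightarrow> (S \<union> T) \<inter> C = T \<inter> C"
          using that dj(2) by auto
        then show ?thesis
          using insert.hyps by (simp add: X_def)
      qed
      \<comment> \<open>The sum splits only for samples inside their own sets, hence on the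
        support.\<close>
      then have "AE ST in pair_pmf (bernoulli_subset p B) (bernoulli_subset p (\<Union>P)).
          g (\<Sum>C\<in>insert B P. F ((case ST of (S, T) \<Rightarrow> S \<union> T) \<inter> C)) = (case ST of (S, T) \<Rightarrow> g (F S + X T))"
        using set_pmf_bernoulli_subset[of p B] set_pmf_bernoulli_subset[of p "\<Union>P"]
        by (intro AE_pmfI) (auto simp: subset_iff)
      then show ?thesis
        using bernoulli_subset_Un[OF fin dj(2), of p]
        by (simp add: integral_cong_AE)
    qed
    have IH: "?E (\<Union>P) X = (\<Sum>C\<in>P. ?E C F)"
      "measure_pmf.variance (bernoulli_subset p (\<Union>P)) X
        = (\<Sum>C\<in>P. measure_pmf.variance (bernoulli_subset p C) F)"
      using insert.IH[OF dj(1)] insert.prems unfolding X_def by auto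
    have int: "integrable (bernoulli_subset p A) f" if "finite A" for f :: "'a set \<Rightarrow> real" and A
      using that by (simp add: integrable_measure_pmf_finite)
    have mean: "?E (\<Union>(insert B P)) (\<lambda>S. \<Sum>C\<in>insert B P. F (S \<inter> C)) = ?E B F + ?E (\<Union>P) X"
      using fin by (subst split[of "\<lambda>x. x"]) (simp add: expectation_pair_pmf_finite int)
    have square: "?E (\<Union>(insert B P)) (\<lambda>S. (\<Sum>C\<in>insert B P. F (S \<inter> C))\<^sup>2)
        = ?E B (\<lambda>S. (F S)\<^sup>2) + 2 * ?E B F * ?E (\<Union>P) X + ?E (\<Union>P) (\<lambda>T. (X T)\<^sup>2)"
      using fin by (subst split[of "\<lambda>x. x\<^sup>2"]) (simp add: expectation_pair_pmf_add_square)
    have "finite (\<Union>(insert B P))" using fin by simp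
    from variance_eq[OF this, of "\<lambda>S. \<Sum>C\<in>insert B P. F (S \<inter> C)"]
    have "measure_pmf.variance (bernoulli_subset p (\<Union>(insert B P))) (\<lambda>S. \<Sum>C\<in>insert B P. F (S \<inter> C))
        = measure_pmf.variance (bernoulli_subset p B) F + measure_pmf.variance (bernoulli_subset p (\<Union>P)) X"
      unfolding mean square variance_eq[OF fin(1)] variance_eq[OF fin(2)]
      by (simp only: power2_sum)
    then show ?case
      using mean IH by (simp only: sum.insert[OF insert.hyps] simp_thms)
  qed
  then show ?mean ?variance by auto
qed

section \<open>The estimator on disjoint unions of cliques\<close>

text \<open>
  On a disjoint union of cliques this is the sum of \<^const>\<open>clique_weight\<close> over the components.
  Expressing it through degrees makes the isomorphism invariance immediate.
\<close>

definition clique_estimator :: "real \<Rightarrow> real \<Rightarrow> (nat, nat \<times> nat) pre_digraph \<Rightarrow> real" where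
  "clique_estimator r l H =
     (\<Sum>v\<in>verts H. clique_weight r l (Suc (out_degree H v)) / real (Suc (out_degree H v)))"

lemma clique_estimator_in_estimators: "clique_estimator r l \<in> estimators"
proof -
  have "clique_estimator r l (app_iso f H) = clique_estimator r l H"
    if "graph H" "pre_digraph.digraph_isomorphism H f" for f and H :: "(nat, nat \<times> nat) pre_digraph"
  proof -
    interpret graph H by fact
    show ?thesis
      unfolding clique_estimator_def verts_app_iso
      using digraph_isomorphism_inj_on_verts[OF that(2)] that(2)
      by (simp add: sum.reindex out_degree_app_iso_eq)
  qed
  then show ?thesis
    unfolding estimators_def digraph_iso_def by auto
qed

section \<open>Components, samples and risk for a fixed disjoint union of cliques\<close>

context
  fixes G :: "nat pair_pre_digraph" and P :: "nat set set"
  assumes G: "pair_graph G"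
    and P: "partition_on (pverts G) P"
    and arcs: "parcs G = (\<Union>B\<in>P. {(u, v). u \<in> B \<and> v \<in> B \<and> u \<noteq> v})"
begin

interpretation pair_graph G by (rule G)

lemma Union_clique_partition: "\<Union>P = pverts G"
  using P by (simp add: partition_on_def)

lemma clique_partition_unique: "B \<in> P \<Longrightarrow> C \<in> P \<Longrightarrow> u \<in> B \<Longrightarrow> u \<in> C \<Longrightarrow> B = C"
  using partition_onD2[OF P] by (auto simp: disjoint_def)

lemma finite_clique_partition: "finite P" "B \<in> P \<Longrightarrow> finite B"
  using Union_clique_partition pair_finite_verts by (metis finite_UnionD, metis Union_upper finite_subset)

text \<open>Arcs never leave a block, and distinct vertices of one block are adjacent.\<close>

lemma clique_reachable_iff: "u \<rightarrow>\<^sup>*\<^bsub>with_proj G\<^esub> v \<longleftrightarrow> (\<exists>B\<in>P. u \<in> B \<and> v \<in> B)"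
proof
  assume "u \<rightarrow>\<^sup>*\<^bsub>with_proj G\<^esub> v"
  then show "\<exists>B\<in>P. u \<in> B \<and> v \<in> B"
  proof (induction rule: reachable_induct)
    case base
    then show ?case using Union_clique_partition by auto
  next
    case (step x y)
    from step(2) obtain C where "C \<in> P" "x \<in> C" "y \<in> C"
      using arcs by auto
    with step(3) show ?case
      using clique_partition_unique by blast
  qed
next
  assume "\<exists>B\<in>P. u \<in> B \<and> v \<in> B"
  then obtain B where B: "B \<in> P" "u \<in> B" "v \<in> B" by blast
  show "u \<rightarrow>\<^sup>*\<^bsub>with_proj G\<^esub> v"
  proof (cases "u = v")
    case True
    then show ?thesis using B Union_clique_partition by auto
  next
    case False
    then have "(u, v) \<in> parcs G" using B arcs by auto
    then show ?thesis by (intro reachable_adjI) simp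
  qed
qed

lemma cc_clique_graph: "cc G = card P"
proof -
  have "sccs_verts = P"
  proof (rule set_eqI)
    fix S
    show "S \<in> sccs_verts \<longleftrightarrow> S \<in> P"
    proof
      assume S: "S \<in> sccs_verts"
      then obtain u where u: "u \<in> S" "u \<rightarrow>\<^sup>*\<^bsub>with_proj G\<^esub> u"
        unfolding sccs_verts_def by auto
      then obtain B where B: "B \<in> P" "u \<in> B"
        using clique_reachable_iff by auto
      have "S = B"
      proof
        show "S \<subseteq> B"
          using S u B clique_partition_unique unfolding sccs_verts_def clique_reachable_iff by blast
        show "B \<subseteq> S"
          using S u B unfolding sccs_verts_def clique_reachable_iff by blast
      qed
      with B show "S \<in> P" by simp
    next
      assume "S \<in> P"
      then show "S \<in> sccs_verts"
        using partition_onD3[OF P] clique_partition_unique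
        unfolding sccs_verts_def clique_reachable_iff by blast
    qed
  qed
  then show ?thesis
    by (simp add: cc_def flip: card_sccs_verts)
qed

lemma card_clique_partition_le: "card P \<le> card (pverts G)"
proof -
  have "card P \<le> (\<Sum>B\<in>P. card B)"
    using partition_onD3[OF P] finite_clique_partition
    by (intro sum_mono[of P "\<lambda>_. 1::nat" card, simplified]) (metis Suc_leI card_gt_0_iff)
  also have "\<dots> = card (\<Union>P)"
    using partition_onD2[OF P] finite_clique_partition
    by (intro card_Union_disjoint[symmetric]) (auto simp: disjoint_def pairwise_def disjnt_def)
  finally show ?thesis
    by (simp add: Union_clique_partition)
qed

text \<open>A sampled vertex of \<open>B\<close> has degree \<open>card (S \<inter> B) - 1\<close>,
  so the sampled vertices of \<open>B\<close> contribute equal shares of one clique weight.\<close>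

lemma clique_estimator_sample:
  assumes S: "S \<subseteq> pverts G"
  shows "clique_estimator r l (with_proj G \<restriction> S) = (\<Sum>B\<in>P. clique_weight r l (card (S \<inter> B)))"
proof -
  have deg: "Suc (out_degree (with_proj G \<restriction> S) v) = card (S \<inter> B)" if "B \<in> P" "v \<in> S \<inter> B" for v B
  proof -
    have "out_arcs (with_proj G \<restriction> S) v = Pair v ` (S \<inter> B - {v})"
      using that arcs clique_partition_unique by (auto simp: out_arcs_def) blast
    moreover have "finite (S \<inter> B)"
      using that finite_clique_partition by auto
    ultimately show ?thesis
      using that by (simp add: out_degree_def card_image inj_on_def card_Suc_Diff1 del: card_Diff_insert)
  qed
  have "clique_estimator r l (with_proj G \<restriction> S)
      = (\<Sum>v\<in>(\<Union>B\<in>P. S \<inter> B). clique_weight r l (Suc (out_degree (with_proj G \<restriction> S) v))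
           / real (Suc (out_degree (with_proj G \<restriction> S) v)))"
    unfolding clique_estimator_def using S Union_clique_partition by (intro sum.cong) auto
  also have "\<dots> = (\<Sum>B\<in>P. \<Sum>v\<in>S \<inter> B. clique_weight r l (Suc (out_degree (with_proj G \<restriction> S) v))
           / real (Suc (out_degree (with_proj G \<restriction> S) v)))"
    using finite_clique_partition clique_partition_unique by (intro sum.UNION_disjoint) auto
  also have "\<dots> = (\<Sum>B\<in>P. clique_weight r l (card (S \<inter> B)))"
  proof (rule sum.cong)
    fix B assume B: "B \<in> P"
    then have "finite (S \<inter> B)" using finite_clique_partition by auto
    moreover have "(\<Sum>v\<in>S \<inter> B. clique_weight r l (Suc (out_degree (with_proj G \<restriction> S) v))
        / real (Suc (out_degree (with_proj G \<restriction> S) v)))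
        = (\<Sum>v\<in>S \<inter> B. clique_weight r l (card (S \<inter> B)) / real (card (S \<inter> B)))"
      using deg[OF B] by (intro sum.cong refl) presburger
    \<comment> \<open>A block missed by the sample gives an empty sum, matching the weight
      \<open>0\<close> at \<open>0\<close>.\<close>
    ultimately show "(\<Sum>v\<in>S \<inter> B. clique_weight r l (Suc (out_degree (with_proj G \<restriction> S) v))
        / real (Suc (out_degree (with_proj G \<restriction> S) v))) = clique_weight r l (card (S \<inter> B))"
      by (cases "S \<inter> B = {}") auto
  qed simp
  finally show ?thesis .
qed

text \<open>Bias-variance decomposition. Hypothesis \<open>eq\<close> gives the variance bound the
  same prefactor as the squared bias bound.\<close>

lemma risk_clique_estimator_le:
  assumes p: "0 < p" "p < 1 / 2" and l: "0 < l"
    and eq: "4 * exp (2 * l * ((1 - p) / p - 1)) = real (card (pverts G)) * exp (- l)"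
  shows "risk p (clique_estimator ((1 - p) / p) l) G \<le> ennreal ((real (card (pverts G)))\<^sup>2 * exp (- l))"
proof -
  let ?N = "real (card (pverts G))" and ?w = "clique_weight ((1 - p) / p) l"
  let ?D = "bernoulli_subset p (pverts G)"
  define X where "X S = (\<Sum>B\<in>P. ?w (card (S \<inter> B)))" for S
  have fin: "finite (pverts G)" by simp
  have int: "integrable (bernoulli_subset p A) f" if "finite A" for f :: "nat set \<Rightarrow> real" and A
    using that by (simp add: integrable_measure_pmf_finite)
  have p': "p \<in> {0..1}" using p by auto
  have E: "measure_pmf.expectation (bernoulli_subset p B) (\<lambda>S. f (card S))
      = measure_pmf.expectation (binomial_pmf (card B) p) f" if "finite B" for B :: "nat set" and f :: "nat \<Rightarrow> real"
    unfolding map_pmf_card_bernoulli_subset[OF that p', symmetric] by simp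
  \<comment> \<open>This is minus the bias from block \<open>B\<close>; blocks are nonempty, so
    \<open>card B - 1\<close> is not truncated on them.\<close>
  define b where "b B = (1 - p) ^ card B * (exp (- l) * laguerre (card B - 1) l)" for B :: "nat set"
  have mean: "measure_pmf.expectation ?D X = real (card P) - (\<Sum>B\<in>P. b B)"
  proof -
    have "measure_pmf.expectation (bernoulli_subset p B) (\<lambda>S. ?w (card S)) = 1 - b B" if "B \<in> P" for B
    proof -
      have B: "finite B" "B \<noteq> {}"
        using that partition_onD3[OF P] finite_clique_partition by auto
      then obtain k where k: "card B = Suc k"
        by (cases "card B") auto
      show ?thesis
        unfolding E[OF B(1), of ?w] k b_def using p by (subst expectation_clique_weight) auto
    qed
    then show ?thesis
      using bernoulli_subset_block_sum(1)[OF finite_clique_partition(1) partition_onD2[OF P] finite_clique_partition(2),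
          of p "\<lambda>S. ?w (card S)"]
      by (simp add: X_def[abs_def] Union_clique_partition sum_subtractf)
  qed
  have bias: "(\<Sum>B\<in>P. b B)\<^sup>2 \<le> ?N * exp (- l) * (\<Sum>B\<in>P. (1 - p) ^ card B)"
  proof -
    have "(b B)\<^sup>2 \<le> exp (- l) * (1 - p) ^ card B" for B
    proof -
      have "(b B)\<^sup>2 = ((1 - p) ^ card B)\<^sup>2 * (exp (- l) * exp (- l) * (laguerre (card B - 1) l)\<^sup>2)"
        by (simp add: b_def power_mult_distrib power2_eq_square)
      \<comment> \<open>The Laguerre bound absorbs one factor \<open>exp (- l)\<close>. One power of
        \<open>(1 - p) ^ card B\<close> is given up so that the other can pair with the variance
        bound.\<close>
      also have "\<dots> \<le> (1 - p) ^ card B * (exp (- l) * exp (- l) * exp l)"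
        using p laguerre_square_le[OF l]
        by (intro mult_mono) (auto simp: power2_eq_square mult_left_le power_le_one)
      also have "exp (- l) * exp (- l) * exp l = exp (- l)"
        by (simp flip: exp_add)
      finally show ?thesis by (simp only: mult.commute)
    qed
    then have *: "(\<Sum>B\<in>P. (b B)\<^sup>2) \<le> exp (- l) * (\<Sum>B\<in>P. (1 - p) ^ card B)"
      by (simp add: sum_distrib_left sum_mono)
    have "(\<Sum>B\<in>P. b B)\<^sup>2 \<le> real (card P) * (\<Sum>B\<in>P. (b B)\<^sup>2)"
      using Cauchy_Schwarz_ineq_sum[of "\<lambda>_. 1" b P] by simp
    also have "\<dots> \<le> ?N * (\<Sum>B\<in>P. (b B)\<^sup>2)"
      using card_clique_partition_le by (intro mult_right_mono sum_nonneg) auto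
    also have "\<dots> \<le> ?N * (exp (- l) * (\<Sum>B\<in>P. (1 - p) ^ card B))"
      using * by (intro mult_left_mono) auto
    finally show ?thesis
      by (simp only: mult.assoc)
  qed
  have variance: "measure_pmf.variance ?D X \<le> ?N * exp (- l) * (\<Sum>B\<in>P. 1 - (1 - p) ^ card B)"
  proof -
    have "measure_pmf.variance (bernoulli_subset p B) (\<lambda>S. ?w (card S)) \<le> ?N * exp (- l) * (1 - (1 - p) ^ card B)"
      if "B \<in> P" for B
    proof -
      have B: "finite B" using that finite_clique_partition by simp
      have "measure_pmf.variance (bernoulli_subset p B) (\<lambda>S. ?w (card S))
          \<le> measure_pmf.expectation (bernoulli_subset p B) (\<lambda>S. (?w (card S))\<^sup>2)"
        using B by (subst measure_pmf.variance_eq) (auto intro: int)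
      also have "\<dots> \<le> (1 - (1 - p) ^ card B) * (?N * exp (- l))"
        unfolding E[OF B, of "\<lambda>i. (?w i)\<^sup>2"] eq[symmetric]
        using p l by (intro expectation_clique_weight_square_le) auto
      finally show ?thesis by (simp add: mult_ac)
    qed
    then show ?thesis
      using bernoulli_subset_block_sum(2)[OF finite_clique_partition(1) partition_onD2[OF P] finite_clique_partition(2),
          of p "\<lambda>S. ?w (card S)"]
      by (simp add: X_def[abs_def] Union_clique_partition sum_distrib_left sum_mono)
  qed
  have mse: "measure_pmf.expectation ?D (\<lambda>S. (X S - real (card P))\<^sup>2) \<le> ?N\<^sup>2 * exp (- l)"
  proof -
    have "measure_pmf.expectation ?D (\<lambda>S. (X S - real (card P))\<^sup>2)
        = measure_pmf.variance ?D X + (measure_pmf.expectation ?D X - real (card P))\<^sup>2"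
      unfolding measure_pmf.variance_eq[OF int[OF fin] int[OF fin]]
      by (simp add: power2_diff int algebra_simps)
    also have "\<dots> = measure_pmf.variance ?D X + (\<Sum>B\<in>P. b B)\<^sup>2"
      unfolding mean by simp
    also have "\<dots> \<le> ?N * exp (- l) * (\<Sum>B\<in>P. 1 - (1 - p) ^ card B) + ?N * exp (- l) * (\<Sum>B\<in>P. (1 - p) ^ card B)"
      using bias variance by (rule add_mono[rotated])
    \<comment> \<open>The weights of each block add up to \<open>1\<close>.\<close>
    also have "\<dots> = ?N * exp (- l) * real (card P)"
      by (simp add: sum_subtractf algebra_simps)
    also have "\<dots> \<le> ?N * exp (- l) * ?N"
      using card_clique_partition_le by (intro mult_left_mono) auto
    finally show ?thesis by (simp add: power2_eq_square mult_ac)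
  qed
  have "risk p (clique_estimator ((1 - p) / p) l) G = (\<integral>\<^sup>+ S. ennreal ((X S - real (card P))\<^sup>2) \<partial>?D)"
    unfolding risk_def sampled_graph_def nn_integral_map_pmf
    using set_pmf_bernoulli_subset[of p "pverts G"]
    by (intro nn_integral_cong_AE AE_pmfI) (auto simp: clique_estimator_sample cc_clique_graph X_def subset_iff)
  also have "\<dots> = ennreal (measure_pmf.expectation ?D (\<lambda>S. (X S - real (card P))\<^sup>2))"
    by (intro nn_integral_eq_integral int) auto
  finally show ?thesis
    using mse by (simp add: ennreal_leI)
qed

end

section \<open>Choice of the smoothing parameter and the minimax bound\<close>

theorem theorem4:
  fixes N :: nat and p :: real
  assumes "N \<ge> 1" and "0 < p" and "p < 1 / 2"
  shows "(INF h \<in> estimators. SUP G \<in> clique_graphs N. risk p h G)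
           \<le> ennreal ((real N)\<^sup>2 * (real N / 4) powr (- (p / (2 - 3 * p))))"
proof (cases "N \<le> 4")
  case True
  \<comment> \<open>Here \<open>ln (N / 4)\<close> is not positive, so neither is the
    \<open>l\<close> of the other case; but the claimed bound is at least \<open>N\<close>
    squared.\<close>
  have "1 \<le> (real N / 4) powr (- (p / (2 - 3 * p)))"
    using True assms by (simp add: powr_minus one_le_inverse_iff powr_le1)
  then have le: "(real N)\<^sup>2 \<le> (real N)\<^sup>2 * (real N / 4) powr (- (p / (2 - 3 * p)))"
    by (simp add: mult_le_cancel_left1)
  have "risk p (\<lambda>_. 0) G \<le> ennreal ((real N)\<^sup>2)" if "G \<in> clique_graphs N" for G
  proof -
    from that obtain P where G: "pair_graph G" "card (pverts G) = N" "partition_on (pverts G) P"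
      "parcs G = (\<Union>B\<in>P. {(u, v). u \<in> B \<and> v \<in> B \<and> u \<noteq> v})"
      by (auto simp: clique_graphs_def disjoint_union_of_cliques_def)
    then have "cc G \<le> N"
      using cc_clique_graph[of G P] card_clique_partition_le[of G P] by simp
    then show ?thesis
      by (auto simp: risk_def intro!: ennreal_leI power_mono)
  qed
  then have "(SUP G \<in> clique_graphs N. risk p (\<lambda>_. 0) G) \<le> ennreal ((real N)\<^sup>2)"
    by (rule SUP_least)
  also have "\<dots> \<le> ennreal ((real N)\<^sup>2 * (real N / 4) powr (- (p / (2 - 3 * p))))"
    by (rule ennreal_leI[OF le])
  finally show ?thesis
    by (intro INF_lower2[of "\<lambda>_. 0"]) (simp_all add: estimators_def)
next
  case False
  \<comment> \<open>This solves \<open>eq\<close> below, since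
    \<open>2 * ((1 - p) / p - 1) + 1 = (2 - 3 * p) / p\<close>.\<close>
  define l where "l = p / (2 - 3 * p) * ln (real N / 4)"
  have l: "0 < l"
    using False assms by (simp add: l_def)
  have exp_l: "exp (- l) = (real N / 4) powr (- (p / (2 - 3 * p)))"
    using False by (simp add: l_def powr_def)
  have eq: "4 * exp (2 * l * ((1 - p) / p - 1)) = real N * exp (- l)"
  proof -
    have "2 * l * ((1 - p) / p - 1) = l * ((2 - 3 * p) / p) - l"
      using assms by (simp add: field_simps)
    also have "l * ((2 - 3 * p) / p) = ln (real N / 4)"
      using assms by (simp add: l_def)
    finally have "exp (2 * l * ((1 - p) / p - 1)) = exp (ln (real N / 4)) * exp (- l)"
      by (simp flip: exp_add)
    then show ?thesis
      using False by simp
  qed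
  have "risk p (clique_estimator ((1 - p) / p) l) G \<le> ennreal ((real N)\<^sup>2 * exp (- l))"
    if "G \<in> clique_graphs N" for G
  proof -
    from that obtain P where G: "pair_graph G" "card (pverts G) = N" "partition_on (pverts G) P"
      "parcs G = (\<Union>B\<in>P. {(u, v). u \<in> B \<and> v \<in> B \<and> u \<noteq> v})"
      by (auto simp: clique_graphs_def disjoint_union_of_cliques_def)
    then show ?thesis
      using risk_clique_estimator_le[of G P p l] assms l eq by simp
  qed
  then have "(SUP G \<in> clique_graphs N. risk p (clique_estimator ((1 - p) / p) l) G)
      \<le> ennreal ((real N)\<^sup>2 * exp (- l))"
    by (rule SUP_least)
  then show ?thesis
    unfolding exp_l by (rule INF_lower2[OF clique_estimator_in_estimators])
qed

end
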